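(* For $n\ge 2$ let $V_n$ be the number of vertices of the polytope $Q_n$. Then, as formal power series, $$x+\sum_{n\geq 2} V_n\,x^n = x+14x^2+150x^3+1536x^4+\cdots=\frac{x+x^2-x^3}{1-13x+31x^2-20x^3+4x^4}.$$
   Context: In $\mathbb{R}^{3\times n}\cong\mathbb{R}^{3n}$ with standard basis $\{e_{i,j}: 0\le i\le 2,\ 0\le j\le n-1\}$, for $0\le i\le 1$ and $0\le j\le n-2$ let $\Delta_{i,j}=\operatorname{conv}\{e_{i,j},e_{i,j+1},e_{i+1,j},e_{i+1,j+1}\}$. The polytope $Q_n$ is the Minkowski sum of these $2(n-1)$ simplices, $Q_n=\sum_{0\le i\le 1,\ 0\le j\le n-2}\Delta_{i,j}$. *)

theory Defs
  imports
    "HOL-Analysis.Finite_Function_Topology"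
    "HOL-Analysis.Polytope"
    "HOL-Computational_Algebra.Formal_Power_Series"
begin

text \<open>
  Since \<open>n\<close> varies inside the generating function, all the spaces of real \<open>3 \<times> n\<close> matrices are
  regarded as coordinate subspaces of one real vector space, the finitely supported functions
  \<open>(nat \<times> nat) \<Rightarrow>\<^sub>0 real\<close>. Convex hulls, Minkowski sums and extreme points do not depend on the
  ambient space.
\<close>

definition std_basis :: "nat \<Rightarrow> nat \<Rightarrow> ((nat \<times> nat) \<Rightarrow>\<^sub>0 real)" where
  "std_basis i j = Poly_Mapping.single (i, j) 1"

definition Delta :: "nat \<Rightarrow> nat \<Rightarrow> ((nat \<times> nat) \<Rightarrow>\<^sub>0 real) set" where
  "Delta i j = convex hull
     {std_basis i j, std_basis i (j + 1), std_basis (i + 1) j, std_basis (i + 1) (j + 1)}"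

text \<open>
  The sum is the Minkowski sum of sets from \<open>HOL-Library.Set_Algebras\<close>. The bound \<open>j < n - 1\<close>
  renders \<open>0 \<le> j \<le> n - 2\<close>.
\<close>

definition Q :: "nat \<Rightarrow> ((nat \<times> nat) \<Rightarrow>\<^sub>0 real) set" where
  "Q n = (\<Sum>(i, j) \<in> {0..1} \<times> {0..<n - 1}. Delta i j)"

definition num_vertices :: "nat \<Rightarrow> nat" where
  "num_vertices n = card {v. v extreme_point_of Q n}"

end

theory Submission
  imports Defs
begin

text \<open>
  A vertex of a Minkowski sum of coordinate simplices selects one corner of every summand, and a
  selection \<open>c\<close> arises from a vertex iff the relation ``the selected corner beats the other corners
  of its simplex'' is acyclic: heights along an acyclic relation give a linear functional that is
  maximal exactly at the selected point, whereas trading each selected corner along a cycle yields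
  a second selection with the same sum, which is impossible at an extreme point.

  The acyclic selections are counted column by column. What the left part of the grid imposes on
  the rest is the transitive closure of the relation restricted to the last column, a strict
  partial order on three elements. Only eleven such orders occur, and on all of them the
  numbers of acyclic extensions satisfy the linear recurrence given by the denominator.
\<close>

section \<open>Vertices of sums of simplices\<close>

text \<open>The first component is the larger one: a functional with its unique maximum at the
  selected point must decrease along every pair.\<close>

definition choice_rel :: "('s \<Rightarrow> 'v set) \<Rightarrow> 's set \<Rightarrow> ('s \<Rightarrow> 'v) \<Rightarrow> ('v \<times> 'v) set" where
  "choice_rel K I c = (\<Union>s\<in>I. {c s} \<times> (K s - {c s}))"

definition choice_point :: "'s set \<Rightarrow> ('s \<Rightarrow> 'v) \<Rightarrow> ('v \<Rightarrow>\<^sub>0 real)" where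
  "choice_point I c = (\<Sum>s\<in>I. Poly_Mapping.single (c s) 1)"

text \<open>Acyclic orientations of the hypergraph with hyperedges \<open>K s\<close>, each
  hyperedge picking one head. Extensionality of \<open>Pi\<^sub>E\<close> makes them countable as
  choices on \<open>I\<close>.\<close>

definition acyclic_choices :: "('s \<Rightarrow> 'v set) \<Rightarrow> 's set \<Rightarrow> ('s \<Rightarrow> 'v) set" where
  "acyclic_choices K I = {c \<in> Pi\<^sub>E I K. acyclic (choice_rel K I c)}"

definition hypergraphic_polytope :: "('s \<Rightarrow> 'v set) \<Rightarrow> 's set \<Rightarrow> ('v \<Rightarrow>\<^sub>0 real) set" where
  "hypergraphic_polytope K I = (\<Sum>s\<in>I. convex hull ((\<lambda>x. Poly_Mapping.single x 1) ` K s))"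

lemma lookup_scaleR:
  fixes f :: "'a \<Rightarrow>\<^sub>0 'b::real_vector"
  shows "Poly_Mapping.lookup (r *\<^sub>R f) x = r *\<^sub>R Poly_Mapping.lookup f x"
proof -
  have "finite {x. r *\<^sub>R Poly_Mapping.lookup f x \<noteq> 0}"
    by (rule finite_subset[OF _ finite_lookup[of f]]) auto
  then show ?thesis
    by (simp add: scaleR_poly_mapping_def)
qed

text \<open>The height of a vertex is the number of vertices reachable from it. The drop along a
  pair is strict because \<open>b\<close> is reachable from \<open>a\<close> but, by acyclicity, not
  from itself.\<close>

lemma acyclic_finite_height:
  assumes "finite R" "acyclic R"
  obtains w :: "'v \<Rightarrow> nat" where "\<And>a b. (a, b) \<in> R \<Longrightarrow> w b < w a"
proof
  fix a b assume ab: "(a, b) \<in> R"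
  have fin: "finite (R\<^sup>+ `` {x})" for x
    using assms(1) by (meson finite_Image finite_trancl)
  have "b \<notin> R\<^sup>+ `` {b}" "b \<in> R\<^sup>+ `` {a}"
    using assms(2) ab by (auto simp: acyclic_def)
  moreover have "R\<^sup>+ `` {b} \<subseteq> R\<^sup>+ `` {a}"
    using ab by (auto intro: trancl_into_trancl2)
  ultimately have "R\<^sup>+ `` {b} \<subset> R\<^sup>+ `` {a}" by blast
  then show "card (R\<^sup>+ `` {b}) < card (R\<^sup>+ `` {a})"
    using fin by (rule psubset_card_mono[rotated])
qed

text \<open>Convex hulls commute with finite Minkowski sums, and one unit vector from each summand
  adds up to a choice point.\<close>

lemma hypergraphic_polytope_eq_hull:
  assumes "finite I"
  shows "hypergraphic_polytope K I = convex hull (choice_point I ` Pi\<^sub>E I K)"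
proof -
  have "hypergraphic_polytope K I
      = convex hull (\<Sum>s\<in>I. (\<lambda>x. Poly_Mapping.single x 1 :: 'b \<Rightarrow>\<^sub>0 real) ` K s)"
    by (simp add: hypergraphic_polytope_def convex_hull_set_sum)
  also have "(\<Sum>s\<in>I. (\<lambda>x. Poly_Mapping.single x 1 :: 'b \<Rightarrow>\<^sub>0 real) ` K s) = choice_point I ` Pi\<^sub>E I K"
  proof (intro equalityI subsetI)
    fix v assume "v \<in> (\<Sum>s\<in>I. (\<lambda>x. Poly_Mapping.single x 1 :: 'b \<Rightarrow>\<^sub>0 real) ` K s)"
    then obtain f where v: "v = sum f I"
      and "\<forall>s\<in>I. \<exists>x. x \<in> K s \<and> f s = Poly_Mapping.single x 1"
      unfolding set_sum_alt[OF assms] by blast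
    then obtain c where c: "\<forall>s\<in>I. c s \<in> K s \<and> f s = Poly_Mapping.single (c s) 1"
      by (auto simp: bchoice_iff)
    then have "v = choice_point I (restrict c I)"
      by (simp add: v choice_point_def)
    with c show "v \<in> choice_point I ` Pi\<^sub>E I K" by auto
  next
    fix v assume "v \<in> choice_point I ` Pi\<^sub>E I K"
    then show "v \<in> (\<Sum>s\<in>I. (\<lambda>x. Poly_Mapping.single x 1 :: 'b \<Rightarrow>\<^sub>0 real) ` K s)"
      unfolding set_sum_alt[OF assms] choice_point_def by (auto simp: PiE_iff)
  qed
  finally show ?thesis .
qed

text \<open>Exchange the two selections at a single \<open>s\<close>: the resulting points
  \<open>a\<close> and \<open>b\<close> lie in the polytope and have the common sum as midpoint, so
  extremality forces \<open>a = b\<close>.\<close>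

lemma choice_point_unique:
  assumes fin: "finite I" and c: "c \<in> Pi\<^sub>E I K" and c': "c' \<in> Pi\<^sub>E I K"
    and ext: "choice_point I c extreme_point_of hypergraphic_polytope K I"
    and eq: "choice_point I c' = choice_point I c"
  shows "c' = c"
proof (rule PiE_ext[OF c' c])
  fix s assume s: "s \<in> I"
  let ?v = "choice_point I c"
  let ?e = "\<lambda>x. Poly_Mapping.single x 1 :: 'b \<Rightarrow>\<^sub>0 real"
  have swap: "choice_point I (d(s := y)) = choice_point I d - ?e (d s) + ?e y" for d y
    using fin s by (simp add: choice_point_def sum.remove)
  have mem: "choice_point I (d(s := y)) \<in> hypergraphic_polytope K I"
    if "d \<in> Pi\<^sub>E I K" "y \<in> K s" for d y
    unfolding hypergraphic_polytope_eq_hull[OF fin]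
    using that s by (intro hull_inc imageI) (auto simp: PiE_iff extensional_def)
  define a b where "a = ?v - ?e (c s) + ?e (c' s)" and "b = ?v - ?e (c' s) + ?e (c s)"
  have "a \<in> hypergraphic_polytope K I" "b \<in> hypergraphic_polytope K I"
    using mem[OF c, of "c' s"] mem[OF c', of "c s"] c c' s
    unfolding swap a_def b_def eq by (auto simp: PiE_iff)
  moreover have "?v = midpoint a b"
    unfolding midpoint_def a_def b_def by (simp add: scaleR_2[symmetric])
  ultimately have "a = b"
    using ext by (metis extreme_point_of_def midpoint_in_open_segment)
  then have "2 *\<^sub>R ?e (c' s) = 2 *\<^sub>R ?e (c s)"
    unfolding a_def b_def scaleR_2 by (simp add: algebra_simps)
  then have "?e (c' s) = ?e (c s)" by simp
  then show "c' s = c s"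
    by (metis lookup_single_eq lookup_single_not_eq zero_neq_one)
qed

text \<open>
  Non-well-foundedness gives a self-map \<open>f\<close> sending an element to one that beats it. On a minimal
  nonempty invariant set \<open>B\<close> it is a permutation, and replacing \<open>f a\<close> by \<open>a\<close> for all \<open>a \<in> B\<close> in the
  selection leaves the sum unchanged.
\<close>

lemma extreme_imp_acyclic:
  fixes K :: "'s \<Rightarrow> 'v set"
  assumes fin: "finite I" and finK: "\<forall>s\<in>I. finite (K s)" and c: "c \<in> Pi\<^sub>E I K"
    and ext: "choice_point I c extreme_point_of hypergraphic_polytope K I"
  shows "acyclic (choice_rel K I c)"
proof (rule ccontr)
  let ?R = "choice_rel K I c"
  assume "\<not> acyclic ?R"
  then have "\<not> wf ?R" using wf_acyclic by blast
  then obtain A x where "x \<in> A" and "\<And>a. a \<in> A \<Longrightarrow> \<exists>b. (b, a) \<in> ?R \<and> b \<in> A"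
    unfolding wf_eq_minimal by auto
  then have "A \<noteq> {}" and A: "\<forall>a\<in>A. \<exists>b\<in>A. (b, a) \<in> ?R" by auto
  have "finite ?R" using fin finK by (auto simp: choice_rel_def)
  moreover have "A \<subseteq> snd ` ?R" using A by force
  ultimately have "finite A" by (meson finite_imageI finite_subset)
  from A obtain f where f: "\<And>a. a \<in> A \<Longrightarrow> f a \<in> A \<and> (f a, a) \<in> ?R" by metis
  let ?F = "{B. B \<subseteq> A \<and> B \<noteq> {} \<and> f ` B \<subseteq> B}"
  have "finite ?F" using \<open>finite A\<close> by simp
  moreover have "A \<in> ?F" using f \<open>A \<noteq> {}\<close> by auto
  ultimately have "\<exists>B\<in>?F. B \<subseteq> A \<and> (\<forall>C\<in>?F. C \<subseteq> B \<longrightarrow> B = C)"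
    by (rule finite_has_minimal2)
  then obtain B where B: "B \<in> ?F" and min: "\<And>C. C \<in> ?F \<Longrightarrow> C \<subseteq> B \<Longrightarrow> B = C"
    by (elim bexE conjE) (rule that, assumption, simp only: Ball_def)
  from B have B: "B \<subseteq> A" "B \<noteq> {}" "f ` B \<subseteq> B" by simp_all
  then have "f ` B \<in> ?F" by (simp add: image_mono order_trans[of _ B A])
  from min[OF this] B(3) have fB: "f ` B = B" by simp
  have "finite B" using B(1) \<open>finite A\<close> by (rule finite_subset)
  then have injf: "inj_on f B" using fB by (simp add: eq_card_imp_inj_on)
  have "\<forall>a\<in>B. \<exists>s\<in>I. f a = c s \<and> a \<in> K s \<and> a \<noteq> c s"
  proof
    fix a assume "a \<in> B"
    then have "(f a, a) \<in> ?R" using B(1) f by blast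
    then show "\<exists>s\<in>I. f a = c s \<and> a \<in> K s \<and> a \<noteq> c s" by (auto simp: choice_rel_def)
  qed
  then obtain \<sigma> where \<sigma>: "\<And>a. a \<in> B \<Longrightarrow> \<sigma> a \<in> I \<and> f a = c (\<sigma> a) \<and> a \<in> K (\<sigma> a) \<and> a \<noteq> c (\<sigma> a)"
    by metis
  \<comment> \<open>Since \<open>f a = c (\<sigma> a)\<close>, injectivity of \<open>f\<close> on
    \<open>B\<close> passes to \<sigma>; hence the replacements defining \<open>c'\<close> do not
    collide.\<close>
  have inj\<sigma>: "inj_on \<sigma> B" using injf \<sigma> by (metis inj_on_def)
  define c' where "c' s = (if s \<in> \<sigma> ` B then the_inv_into B \<sigma> s else c s)" for s
  have c'\<sigma>: "c' (\<sigma> a) = a" if "a \<in> B" for a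
    using that inj\<sigma> by (simp add: c'_def the_inv_into_f_f)
  have sub: "\<sigma> ` B \<subseteq> I" using \<sigma> by auto
  have "c' \<in> Pi\<^sub>E I K"
  proof (rule PiE_I)
    fix s assume "s \<in> I"
    show "c' s \<in> K s"
    proof (cases "s \<in> \<sigma> ` B")
      case True then show ?thesis using c'\<sigma> \<sigma> by auto
    next
      case False then show ?thesis using c \<open>s \<in> I\<close> by (auto simp: c'_def)
    qed
  next
    fix s assume "s \<notin> I"
    then show "c' s = undefined" using sub c by (auto simp: c'_def)
  qed
  moreover have "choice_point I c' = choice_point I c"
  proof -
    let ?e = "\<lambda>x. Poly_Mapping.single x 1 :: 'v \<Rightarrow>\<^sub>0 real"
    have "(\<Sum>s\<in>\<sigma> ` B. ?e (c' s)) = (\<Sum>a\<in>B. ?e a)"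
      using inj\<sigma> c'\<sigma> by (simp add: sum.reindex)
    also have "\<dots> = (\<Sum>a\<in>f ` B. ?e a)" by (simp add: fB)
    also have "\<dots> = (\<Sum>a\<in>B. ?e (c (\<sigma> a)))"
      unfolding sum.reindex[OF injf] using \<sigma> by (intro sum.cong) auto
    also have "\<dots> = (\<Sum>s\<in>\<sigma> ` B. ?e (c s))"
      using inj\<sigma> by (simp add: sum.reindex)
    finally have *: "(\<Sum>s\<in>\<sigma> ` B. ?e (c' s)) = (\<Sum>s\<in>\<sigma> ` B. ?e (c s))" .
    have "(\<Sum>s\<in>I - \<sigma> ` B. ?e (c' s)) = (\<Sum>s\<in>I - \<sigma> ` B. ?e (c s))"
      by (rule sum.cong) (auto simp: c'_def)
    with * show ?thesis
      unfolding choice_point_def by (simp add: sum.subset_diff[OF sub fin])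
  qed
  ultimately have "c' = c" using choice_point_unique[OF fin c _ ext] by blast
  then show False using B(2) \<sigma> c'\<sigma> by fastforce
qed

text \<open>The heights serve as weights, and each \<open>s\<close> where \<open>c'\<close> differs
  from \<open>c\<close> loses weight. Comparing choices rather than points gives both extremality
  and injectivity of \<open>choice_point\<close>.\<close>

lemma acyclic_choice_separating_functional:
  fixes K :: "'s \<Rightarrow> 'v set"
  assumes fin: "finite I" and finK: "\<forall>s\<in>I. finite (K s)" and c: "c \<in> acyclic_choices K I"
  shows "\<exists>\<phi> :: ('v \<Rightarrow>\<^sub>0 real) \<Rightarrow> real. linear \<phi> \<and>
    (\<forall>c'\<in>Pi\<^sub>E I K. c' \<noteq> c \<longrightarrow> \<phi> (choice_point I c') < \<phi> (choice_point I c))"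
proof -
  let ?X = "\<Union>s\<in>I. K s"
  have cP: "c \<in> Pi\<^sub>E I K" and ac: "acyclic (choice_rel K I c)"
    using c by (auto simp: acyclic_choices_def)
  have "finite (choice_rel K I c)" using fin finK by (auto simp: choice_rel_def)
  from acyclic_finite_height[OF this ac] obtain w :: "'v \<Rightarrow> nat"
    where w: "\<And>a b. (a, b) \<in> choice_rel K I c \<Longrightarrow> w b < w a"
    by blast
  define \<phi> :: "('v \<Rightarrow>\<^sub>0 real) \<Rightarrow> real"
    where "\<phi> f = (\<Sum>x\<in>?X. real (w x) * Poly_Mapping.lookup f x)" for f
  have lin: "linear \<phi>"
    by (rule linearI)
      (simp_all add: \<phi>_def lookup_add lookup_scaleR sum.distrib sum_distrib_left distrib_left mult.left_commute)
  have single: "\<phi> (Poly_Mapping.single x 1) = w x" if "x \<in> ?X" for x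
    unfolding \<phi>_def using that fin finK
    by (subst sum.remove[of _ x]) (auto intro!: sum.neutral simp: lookup_single when_def split: if_splits)
  have val: "\<phi> (choice_point I d) = (\<Sum>s\<in>I. real (w (d s)))" if "d \<in> Pi\<^sub>E I K" for d
    unfolding choice_point_def linear_sum[OF lin]
    using that by (intro sum.cong single) (auto simp: PiE_iff)
  show ?thesis
  proof (intro exI[of _ \<phi>] conjI ballI impI lin)
    fix c' assume c': "c' \<in> Pi\<^sub>E I K" "c' \<noteq> c"
    then obtain s where s: "s \<in> I" "c' s \<noteq> c s" using cP by (metis PiE_ext)
    have less: "w (c' s) < w (c s)" if "s \<in> I" "c' s \<noteq> c s" for s
      using that c' by (intro w) (auto simp: choice_rel_def PiE_iff)
    have "(\<Sum>s\<in>I. real (w (c' s))) < (\<Sum>s\<in>I. real (w (c s)))"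
    proof (rule sum_strict_mono_ex1[OF fin])
      show "\<forall>x\<in>I. real (w (c' x)) \<le> real (w (c x))"
        using less by (metis less_imp_le of_nat_le_iff order_refl)
      show "\<exists>a\<in>I. real (w (c' a)) < real (w (c a))" using less s by auto
    qed
    then show "\<phi> (choice_point I c') < \<phi> (choice_point I c)"
      using val c' cP by simp
  qed
qed

text \<open>The open half-space \<open>?L\<close> stays convex when its boundary point
  \<open>v\<close> is added, so the enlarged set contains the hull. Removing \<open>v\<close> from
  the hull therefore leaves a convex set, which characterises extreme points.\<close>

lemma extreme_point_if_strict_maximum:
  fixes \<phi> :: "'a::real_vector \<Rightarrow> real"
  assumes lin: "linear \<phi>" and v: "v \<in> T" and max: "\<And>x. x \<in> T \<Longrightarrow> x \<noteq> v \<Longrightarrow> \<phi> x < \<phi> v"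
  shows "v extreme_point_of (convex hull T)"
proof -
  let ?L = "{x. \<phi> x < \<phi> v}"
  have comb: "\<phi> (a *\<^sub>R x + b *\<^sub>R y) = a * \<phi> x + b * \<phi> y" for a b x y
    using lin by (simp add: linear_add linear_scale)
  have lt: "a * p + b * q < r" if "p \<le> r" "q < r" "0 \<le> a" "0 < b" "a + b = 1" for a b p q r :: real
  proof -
    have "a * p \<le> a * r" "b * q < b * r" using that by (auto intro: mult_left_mono)
    moreover have "a * r + b * r = r" using that by (metis distrib_right mult_1)
    ultimately show ?thesis by linarith
  qed
  have convL: "convex ?L"
    using convex_linear_vimage[OF lin, of "{..<\<phi> v}"] by (simp add: vimage_def)
  have "convex (insert v ?L)"
  proof (rule convexI)
    fix x y and a b :: real
    assume xy: "x \<in> insert v ?L" "y \<in> insert v ?L" and ab: "0 \<le> a" "0 \<le> b" "a + b = 1"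
    consider "x = v" "y = v" | "a = 0" | "b = 0" | "a > 0" "b > 0" "x \<in> ?L \<or> y \<in> ?L"
      using xy ab by fastforce
    then show "a *\<^sub>R x + b *\<^sub>R y \<in> insert v ?L"
    proof cases
      case 1 with ab show ?thesis by (simp flip: scaleR_left_distrib)
    next
      case 2 with ab xy show ?thesis by simp
    next
      case 3 with ab xy show ?thesis by simp
    next
      case 4
      have "\<phi> x \<le> \<phi> v" "\<phi> y \<le> \<phi> v" using xy by auto
      with 4 ab lt[of "\<phi> x" "\<phi> v" "\<phi> y" a b] lt[of "\<phi> y" "\<phi> v" "\<phi> x" b a]
      show ?thesis by (auto simp: comb add.commute)
    qed
  qed
  moreover have "T \<subseteq> insert v ?L" using max by auto
  ultimately have "convex hull T \<subseteq> insert v ?L" by (rule hull_minimal[rotated])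
  then have "convex hull T - {v} = convex hull T \<inter> ?L" by auto
  then show ?thesis
    by (simp add: extreme_point_of_stillconvex v hull_inc convex_Int convL)
qed

lemma card_extreme_points_hypergraphic:
  assumes fin: "finite I" and finK: "\<forall>s\<in>I. finite (K s)"
  shows "card {v. v extreme_point_of hypergraphic_polytope K I} = card (acyclic_choices K I)"
proof -
  note hull = hypergraphic_polytope_eq_hull[OF fin]
  have "{v. v extreme_point_of hypergraphic_polytope K I} = choice_point I ` acyclic_choices K I"
  proof (intro equalityI subsetI)
    fix v assume "v \<in> {v. v extreme_point_of hypergraphic_polytope K I}"
    then have v: "v extreme_point_of hypergraphic_polytope K I" by simp
    then have "v \<in> choice_point I ` Pi\<^sub>E I K"
      unfolding hull by (rule extreme_point_of_convex_hull)
    then obtain c where c: "c \<in> Pi\<^sub>E I K" "v = choice_point I c" by blast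
    have "acyclic (choice_rel K I c)"
      using extreme_imp_acyclic[OF fin finK c(1)] v c(2) by simp
    with c show "v \<in> choice_point I ` acyclic_choices K I"
      by (simp add: acyclic_choices_def)
  next
    fix v assume "v \<in> choice_point I ` acyclic_choices K I"
    then obtain c where c: "c \<in> acyclic_choices K I" "v = choice_point I c" by blast
    obtain \<phi> :: "('b \<Rightarrow>\<^sub>0 real) \<Rightarrow> real" where "linear \<phi>"
      and "\<forall>c'\<in>Pi\<^sub>E I K. c' \<noteq> c \<longrightarrow> \<phi> (choice_point I c') < \<phi> (choice_point I c)"
      using acyclic_choice_separating_functional[OF fin finK c(1)] by blast
    then show "v \<in> {v. v extreme_point_of hypergraphic_polytope K I}"
      unfolding mem_Collect_eq hull using c
      by (intro extreme_point_if_strict_maximum[of \<phi>]) (auto simp: acyclic_choices_def)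
  qed
  moreover have "inj_on (choice_point I) (acyclic_choices K I)"
  proof (rule inj_onI, rule ccontr)
    fix c c' assume c: "c \<in> acyclic_choices K I" and c': "c' \<in> acyclic_choices K I"
      and eq: "choice_point I c = choice_point I c'" and "c \<noteq> c'"
    obtain \<phi> :: "('b \<Rightarrow>\<^sub>0 real) \<Rightarrow> real"
      where \<phi>: "\<forall>c'\<in>Pi\<^sub>E I K. c' \<noteq> c \<longrightarrow> \<phi> (choice_point I c') < \<phi> (choice_point I c)"
      using acyclic_choice_separating_functional[OF fin finK c] by blast
    have "c' \<in> Pi\<^sub>E I K" using c' by (simp add: acyclic_choices_def)
    with \<phi> eq \<open>c \<noteq> c'\<close> show False by (metis less_irrefl)
  qed
  ultimately show ?thesis by (simp add: card_image)
qed

section \<open>Reachability after adding a star of pairs with common source\<close>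

lemma trancl_Un_star:
  "(R \<union> {t} \<times> A)\<^sup>+ = R\<^sup>+ \<union> {(a, b). (a, t) \<in> R\<^sup>* \<and> (\<exists>x\<in>A. (x, b) \<in> R\<^sup>*)}" (is "?S\<^sup>+ = ?T")
proof (intro equalityI subrelI)
  fix a b assume "(a, b) \<in> ?S\<^sup>+"
  then show "(a, b) \<in> ?T"
  proof (induction rule: trancl_induct)
    case (base y)
    then show ?case by auto
  next
    case (step y z)
    from step(2) show ?case
    proof
      assume "(y, z) \<in> R"
      with step(3) show ?thesis by (auto intro: rtrancl_into_rtrancl trancl_into_trancl)
    next
      \<comment> \<open>Here \<open>y = t\<close>, and both cases for \<open>(a, y)\<close> give a
        path from \<open>a\<close> to \<open>t\<close> in \<open>R\<close>. Any earlier use of the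
        star is cut out, so one new pair suffices.\<close>
      assume "(y, z) \<in> {t} \<times> A"
      with step(3) show ?thesis by (auto intro: trancl_into_rtrancl)
    qed
  qed
next
  have mono: "R\<^sup>* \<subseteq> ?S\<^sup>*" "R\<^sup>+ \<subseteq> ?S\<^sup>+" by (auto intro!: rtrancl_mono trancl_mono_subset)
  fix a b assume "(a, b) \<in> ?T"
  then consider "(a, b) \<in> R\<^sup>+" | x where "(a, t) \<in> R\<^sup>*" "x \<in> A" "(x, b) \<in> R\<^sup>*" by auto
  then show "(a, b) \<in> ?S\<^sup>+"
  proof cases
    case 1 with mono show ?thesis by blast
  next
    case 2
    then have "(a, t) \<in> ?S\<^sup>*" "(t, x) \<in> ?S" "(x, b) \<in> ?S\<^sup>*" using mono by auto
    then show ?thesis by (meson rtrancl_into_trancl1 trancl_rtrancl_trancl)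
  qed
qed

lemma acyclic_Un_star:
  "acyclic (R \<union> {t} \<times> A) \<longleftrightarrow> acyclic R \<and> (\<forall>x\<in>A. (x, t) \<notin> R\<^sup>*)"
  unfolding acyclic_def trancl_Un_star by (auto intro: rtrancl_trans)

section \<open>Transfer between columns\<close>

text \<open>
  Columns \<open>m\<close> and \<open>m + 1\<close> are numbered locally, \<open>0, 1, 2\<close> for the former and \<open>3, 4, 5\<close> for the latter.
  Relations on these six vertices are \<open>6 \<times> 6\<close> Boolean matrices, so that the transfer can be computed
  by rewriting.
\<close>

definition node :: "nat \<Rightarrow> nat \<Rightarrow> nat \<times> nat" where
  "node m k = (k mod 3, m + k div 3)"

definition rows_of :: "(nat \<Rightarrow> nat \<Rightarrow> bool) \<Rightarrow> bool list list" where
  "rows_of r = map (\<lambda>a. map (r a) [0..<6]) [0..<6]"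

text \<open>The closure is taken in the whole grid before restricting, so paths through earlier
  columns are recorded.\<close>

definition local_rel :: "nat \<Rightarrow> ((nat \<times> nat) \<times> (nat \<times> nat)) set \<Rightarrow> bool list list" where
  "local_rel m R = rows_of (\<lambda>a b. (node m a, node m b) \<in> R\<^sup>+)"

definition safe :: "bool list list \<Rightarrow> nat \<Rightarrow> nat list \<Rightarrow> bool" where
  "safe D t A \<longleftrightarrow> list_all (\<lambda>x. x \<noteq> t \<and> \<not> D ! x ! t) A"

definition below_star :: "bool list list \<Rightarrow> nat list \<Rightarrow> bool list" where
  "below_star D A = map (\<lambda>b. list_ex (\<lambda>x. x = b \<or> D ! x ! b) A) [0..<6]"

definition put_below :: "bool list list \<Rightarrow> nat \<Rightarrow> bool list \<Rightarrow> bool list list" where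
  "put_below D t u = map (\<lambda>a. if a = t \<or> D ! a ! t then map2 (\<or>) (D ! a) u else D ! a) [0..<6]"

text \<open>Matrix form of \<open>trancl_Un_star\<close>: everything weakly below \<open>A\<close>
  is joined to the row of \<open>t\<close> and to the rows of all vertices that reach
  \<open>t\<close>.\<close>

definition add_star :: "bool list list \<Rightarrow> nat \<Rightarrow> nat list \<Rightarrow> bool list list" where
  "add_star D t A = put_below D t (below_star D A)"

definition square_steps :: "nat list \<Rightarrow> bool list list \<Rightarrow> bool list list list" where
  "square_steps L D = map (\<lambda>t. add_star D t (removeAll t L))
     (filter (\<lambda>t. safe D t (removeAll t L)) L)"

definition shift :: "bool list list \<Rightarrow> bool list list" where
  "shift D = rows_of (\<lambda>a b. a < 3 \<and> b < 3 \<and> D ! (a + 3) ! (b + 3))"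

text \<open>The lists are the corners of the squares \<open>(0, m)\<close> and \<open>(1, m)\<close>
  in local numbering. Repeated results are kept, since they count different selections.\<close>

definition succs :: "bool list list \<Rightarrow> bool list list list" where
  "succs D = map shift (concat (map (square_steps [1,2,4,5]) (square_steps [0,1,3,4] D)))"

text \<open>No closure is taken, so \<open>ps\<close> has to list every pair of the order.\<close>

definition state :: "(nat \<times> nat) list \<Rightarrow> bool list list" where
  "state ps = rows_of (\<lambda>a b. (a, b) \<in> set ps)"

lemma inj_node: "inj (node m)"
  by (rule injI) (metis Pair_inject add_left_cancel div_mult_mod_eq node_def)

lemma node_eq_iff [simp]: "node m a = node m b \<longleftrightarrow> a = b"
  using inj_node by (metis injD)

lemma nth_rows_of: "a < 6 \<Longrightarrow> b < 6 \<Longrightarrow> rows_of r ! a ! b = r a b"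
  by (simp add: rows_of_def)

lemma rows_of_cong:
  assumes "\<And>a b. a < 6 \<Longrightarrow> b < 6 \<Longrightarrow> r a b = r' a b"
  shows "rows_of r = rows_of r'"
  using assms by (simp add: rows_of_def)

lemma nth_local_rel:
  "a < 6 \<Longrightarrow> b < 6 \<Longrightarrow> local_rel m R ! a ! b \<longleftrightarrow> (node m a, node m b) \<in> R\<^sup>+"
  by (simp add: local_rel_def nth_rows_of)

lemma add_star_rows_of:
  "add_star (rows_of r) t A = rows_of (\<lambda>a b. r a b \<or>
     (a = t \<or> rows_of r ! a ! t) \<and> (\<exists>x\<in>set A. x = b \<or> rows_of r ! x ! b))"
proof -
  have "map2 (\<or>) (map p [0..<6]) (map q [0..<6]) = map (\<lambda>b. p b \<or> q b) [0..<6]"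
    for p q :: "nat \<Rightarrow> bool"
    by (rule nth_equalityI) simp_all
  moreover have "rows_of r ! a = map (r a) [0..<6]" if "a < 6" for a
    using that by (simp add: rows_of_def)
  ultimately show ?thesis
    unfolding add_star_def put_below_def below_star_def list_ex_iff rows_of_def[of "\<lambda>a b. r a b \<or> _ a b"]
    by (intro map_cong refl) simp
qed

text \<open>As \<open>t\<close> and \<open>A\<close> lie in the two columns, the new closure there
  depends on \<open>R\<close> only through its old closure there. This is why a finite state
  suffices.\<close>

lemma local_rel_add_star:
  assumes "t < 6" "set A \<subseteq> {..<6}"
  shows "local_rel m (R \<union> {node m t} \<times> node m ` set A) = add_star (local_rel m R) t A"
  unfolding local_rel_def add_star_rows_of
proof (rule rows_of_cong)
  fix a b :: nat assume ab: "a < 6" "b < 6"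
  have "x < 6" if "x \<in> set A" for x using assms(2) that by blast
  with assms(1) ab show "(node m a, node m b) \<in> (R \<union> {node m t} \<times> node m ` set A)\<^sup>+ \<longleftrightarrow>
      (node m a, node m b) \<in> R\<^sup>+ \<or>
      (a = t \<or> rows_of (\<lambda>a b. (node m a, node m b) \<in> R\<^sup>+) ! a ! t) \<and>
      (\<exists>x\<in>set A. x = b \<or> rows_of (\<lambda>a b. (node m a, node m b) \<in> R\<^sup>+) ! x ! b)"
    by (simp add: trancl_Un_star rtrancl_eq_or_trancl nth_rows_of cong: bex_cong) blast
qed

lemma acyclic_add_star:
  assumes "t < 6" "set A \<subseteq> {..<6}"
  shows "acyclic (R \<union> {node m t} \<times> node m ` set A) \<longleftrightarrow> acyclic R \<and> safe (local_rel m R) t A"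
proof -
  have "x < 6" if "x \<in> set A" for x using assms(2) that by blast
  with assms(1) show ?thesis
    by (simp add: acyclic_Un_star safe_def list_all_iff rtrancl_eq_or_trancl nth_local_rel
        cong: ball_cong) blast
qed

text \<open>Local vertex \<open>a + 3\<close> of the old window is vertex \<open>a\<close> of the
  new one, and the column entering the window carries no pairs yet.\<close>

lemma local_rel_Suc:
  assumes "\<And>u v. (u, v) \<in> R \<Longrightarrow> snd u \<le> Suc m \<and> snd v \<le> Suc m"
  shows "local_rel (Suc m) R = shift (local_rel m R)"
proof -
  let ?C = "{u. snd u \<le> Suc m}"
  have "R\<^sup>+ \<subseteq> ?C \<times> ?C"
    using assms by (intro trancl_subset_Sigma) auto
  then have "a < 3 \<and> b < 3" if "(node (Suc m) a, node (Suc m) b) \<in> R\<^sup>+" for a b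
    using that by (force simp: node_def div_eq_0_iff)
  moreover have "node m (a + 3) = node (Suc m) a" for a
    by (simp add: node_def)
  ultimately show ?thesis
    unfolding local_rel_def[of "Suc m"] shift_def
    by (intro rows_of_cong) (auto simp: nth_local_rel)
qed

text \<open>An arbitrary weight \<open>F\<close> on the final matrix allows squares to be removed
  one after another.\<close>

lemma sum_acyclic_choices_insert:
  fixes F :: "bool list list \<Rightarrow> nat"
  assumes fin: "finite I" "\<forall>s\<in>I. finite (K s)" and s: "s \<notin> I"
    and K: "K s = node m ` set L" and L: "distinct L" "set L \<subseteq> {..<6}"
  shows "(\<Sum>c\<in>acyclic_choices K (insert s I). F (local_rel m (choice_rel K (insert s I) c)))
    = (\<Sum>c\<in>acyclic_choices K I. \<Sum>D\<leftarrow>square_steps L (local_rel m (choice_rel K I c)). F D)"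
proof -
  \<comment> \<open>Extension by zero turns the sum over acyclic choices into one over a full
    product, from which the value at \<open>s\<close> splits off.\<close>
  define G where "G R = (if acyclic R then F (local_rel m R) else 0)" for R
  have finP: "finite (Pi\<^sub>E J K)" if "J \<subseteq> insert s I" for J
    using fin K that by (intro finite_PiE) (auto intro: finite_subset)
  have rel: "choice_rel K (insert s I) (g(s := node m t)) =
      choice_rel K I g \<union> {node m t} \<times> node m ` set (removeAll t L)" for g t
  proof -
    have "(\<Union>x\<in>I. {(g(s := node m t)) x} \<times> (K x - {(g(s := node m t)) x})) = choice_rel K I g"
      unfolding choice_rel_def using s by (intro SUP_cong) auto
    moreover have "K s - {node m t} = node m ` set (removeAll t L)"
      by (auto simp: K)
    ultimately show ?thesis by (simp add: choice_rel_def Un_commute)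
  qed
  have "(\<Sum>c\<in>acyclic_choices K (insert s I). F (local_rel m (choice_rel K (insert s I) c)))
      = (\<Sum>c\<in>Pi\<^sub>E (insert s I) K. G (choice_rel K (insert s I) c))"
    unfolding acyclic_choices_def G_def by (rule sum.inter_filter) (simp add: finP)
  also have "\<dots> = (\<Sum>(y, g)\<in>K s \<times> Pi\<^sub>E I K. G (choice_rel K (insert s I) (g(s := y))))"
    unfolding PiE_insert_eq using inj_combinator[OF s, of K]
    by (subst sum.reindex) (auto simp: case_prod_unfold)
  also have "\<dots> = (\<Sum>g\<in>Pi\<^sub>E I K. \<Sum>y\<in>K s. G (choice_rel K (insert s I) (g(s := y))))"
    unfolding sum.cartesian_product[symmetric] by (rule sum.swap)
  also have "\<dots> = (\<Sum>g\<in>Pi\<^sub>E I K. if acyclic (choice_rel K I g)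
      then \<Sum>D\<leftarrow>square_steps L (local_rel m (choice_rel K I g)). F D else 0)"
  proof (rule sum.cong[OF refl])
    fix g
    let ?R = "choice_rel K I g"
    let ?D = "local_rel m ?R"
    have "(\<Sum>y\<in>K s. G (choice_rel K (insert s I) (g(s := y)))) =
        (\<Sum>t\<in>set L. G (choice_rel K (insert s I) (g(s := node m t))))"
      unfolding K by (rule sum.reindex_cong[of "node m"]) (auto simp: inj_on_def)
    also have "\<dots> = (\<Sum>t\<leftarrow>L. G (choice_rel K (insert s I) (g(s := node m t))))"
      by (simp add: L sum.distinct_set_conv_list)
    also have "\<dots> = (\<Sum>t\<leftarrow>L. if acyclic ?R \<and> safe ?D t (removeAll t L)
        then F (add_star ?D t (removeAll t L)) else 0)"
    proof (intro arg_cong[of _ _ sum_list] map_cong refl)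
      fix t assume "t \<in> set L"
      then have "t < 6" "set (removeAll t L) \<subseteq> {..<6}" using L by auto
      then show "G (choice_rel K (insert s I) (g(s := node m t))) =
          (if acyclic ?R \<and> safe ?D t (removeAll t L) then F (add_star ?D t (removeAll t L)) else 0)"
        unfolding G_def rel by (simp only: local_rel_add_star acyclic_add_star)
    qed
    also have "\<dots> = (if acyclic ?R then \<Sum>D\<leftarrow>square_steps L ?D. F D else 0)"
      by (simp add: square_steps_def sum_list_map_filter' o_def)
    finally show "(\<Sum>y\<in>K s. G (choice_rel K (insert s I) (g(s := y)))) =
        (if acyclic ?R then \<Sum>D\<leftarrow>square_steps L ?D. F D else 0)" .
  qed
  also have "\<dots> = (\<Sum>c\<in>acyclic_choices K I. \<Sum>D\<leftarrow>square_steps L (local_rel m (choice_rel K I c)). F D)"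
    unfolding acyclic_choices_def by (rule sum.inter_filter[symmetric]) (auto intro: finP)
  finally show ?thesis .
qed

section \<open>The grid of squares and the iterated transfer\<close>

definition corners :: "nat \<times> nat \<Rightarrow> (nat \<times> nat) set" where
  "corners = (\<lambda>(i, j). {(i, j), (i, j + 1), (i + 1, j), (i + 1, j + 1)})"

text \<open>With \<open>m\<close> squares per row the grid has columns \<open>0\<close> to
  \<open>m\<close>; thus \<open>Q n\<close> belongs to \<open>squares (n - 1)\<close>.\<close>

definition squares :: "nat \<Rightarrow> (nat \<times> nat) set" where
  "squares m = {0..1} \<times> {0..<m}"

lemma finite_corners: "finite (corners s)"
  by (cases s) (simp add: corners_def)

lemma corners_eq_node:
  "corners (0, m) = node m ` set [0,1,3,4]" "corners (1, m) = node m ` set [1,2,4,5]"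
  by (auto simp: corners_def node_def)

lemma squares_Suc: "squares (Suc m) = insert (1, m) (insert (0, m) (squares m))"
  by (auto simp: squares_def)

lemma choice_rel_squares_columns:
  assumes "c \<in> Pi\<^sub>E (squares m) corners" "(u, v) \<in> choice_rel corners (squares m) c"
  shows "snd u \<le> m \<and> snd v \<le> m"
proof -
  obtain s where s: "s \<in> squares m" "u = c s" "v \<in> corners s"
    using assms(2) by (auto simp: choice_rel_def)
  with assms(1) have "u \<in> corners s" by auto
  with s show ?thesis by (auto simp: corners_def squares_def split: prod.splits)
qed

lemma sum_list_succs:
  "(\<Sum>D\<leftarrow>succs D0. F D)
    = (\<Sum>E\<leftarrow>square_steps [0,1,3,4] D0. \<Sum>D\<leftarrow>square_steps [1,2,4,5] E. F (shift D))"
proof -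
  have "(\<Sum>D\<leftarrow>map shift (concat (map f Es)). F D) = (\<Sum>E\<leftarrow>Es. \<Sum>D\<leftarrow>f E. F (shift D))" for f Es
    by (induction Es) (simp_all add: o_def)
  then show ?thesis by (simp add: succs_def)
qed

lemma sum_acyclic_choices_squares_Suc:
  fixes F :: "bool list list \<Rightarrow> nat"
  shows "(\<Sum>c\<in>acyclic_choices corners (squares (Suc m)).
      F (local_rel (Suc m) (choice_rel corners (squares (Suc m)) c)))
    = (\<Sum>c\<in>acyclic_choices corners (squares m).
      \<Sum>D\<leftarrow>succs (local_rel m (choice_rel corners (squares m) c)). F D)"
proof -
  have "(\<Sum>c\<in>acyclic_choices corners (squares (Suc m)).
      F (local_rel (Suc m) (choice_rel corners (squares (Suc m)) c)))
    = (\<Sum>c\<in>acyclic_choices corners (squares (Suc m)).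
      F (shift (local_rel m (choice_rel corners (squares (Suc m)) c))))"
    using choice_rel_squares_columns
    by (intro sum.cong refl arg_cong[of _ _ F] local_rel_Suc) (auto simp: acyclic_choices_def)
  also have "\<dots> = (\<Sum>c\<in>acyclic_choices corners (insert (0, m) (squares m)).
      \<Sum>D\<leftarrow>square_steps [1,2,4,5] (local_rel m (choice_rel corners (insert (0, m) (squares m)) c)).
        F (shift D))"
    unfolding squares_Suc
    by (rule sum_acyclic_choices_insert[where K = corners and s = "(1, m)" and L = "[1,2,4,5]",
        OF _ _ _ corners_eq_node(2)])
      (auto simp: finite_corners squares_def)
  also have "\<dots> = (\<Sum>c\<in>acyclic_choices corners (squares m).
      \<Sum>E\<leftarrow>square_steps [0,1,3,4] (local_rel m (choice_rel corners (squares m) c)).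
        \<Sum>D\<leftarrow>square_steps [1,2,4,5] E. F (shift D))"
    by (rule sum_acyclic_choices_insert[where K = corners and s = "(0, m)" and L = "[0,1,3,4]",
        OF _ _ _ corners_eq_node(1)])
      (auto simp: finite_corners squares_def)
  also have "\<dots> = (\<Sum>c\<in>acyclic_choices corners (squares m).
      \<Sum>D\<leftarrow>succs (local_rel m (choice_rel corners (squares m) c)). F D)"
    by (simp add: sum_list_succs)
  finally show ?thesis .
qed

text \<open>
  The transfer is applied from the right: \<open>extensions k D\<close> is the number of ways to select corners in
  \<open>k\<close> further pairs of squares when the last column carries the order \<open>D\<close>.
\<close>

fun extensions :: "nat \<Rightarrow> bool list list \<Rightarrow> nat" where
  "extensions 0 D = 1"
| "extensions (Suc k) D = (\<Sum>E\<leftarrow>succs D. extensions k E)"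

text \<open>Each induction step moves one pair of squares from the selected part into
  \<open>extensions\<close>. At \<open>k = 0\<close> the left side is the number of acyclic
  choices.\<close>

lemma sum_extensions:
  "(\<Sum>c\<in>acyclic_choices corners (squares m).
     extensions k (local_rel m (choice_rel corners (squares m) c))) = extensions (m + k) (state [])"
proof (induction m arbitrary: k)
  case 0
  have "squares 0 = {}" "choice_rel corners {} = (\<lambda>_. {})"
    by (simp_all add: squares_def choice_rel_def fun_eq_iff)
  moreover have "local_rel 0 {} = state []"
    by (simp add: local_rel_def state_def)
  ultimately show ?case by (simp add: acyclic_choices_def acyclic_def)
next
  case (Suc m)
  from Suc.IH[of "Suc k"] show ?case
    by (simp add: sum_acyclic_choices_squares_Suc)
qed

lemma Q_eq_hypergraphic_polytope: "Q n = hypergraphic_polytope corners (squares (n - 1))"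
  unfolding Q_def hypergraphic_polytope_def squares_def
  by (rule sum.cong) (auto simp: Delta_def corners_def std_basis_def)

lemma num_vertices_eq_extensions: "num_vertices n = extensions (n - 1) (state [])"
proof -
  have "num_vertices n = card (acyclic_choices corners (squares (n - 1)))"
    unfolding num_vertices_def Q_eq_hypergraphic_polytope
    by (rule card_extreme_points_hypergraphic) (simp_all add: squares_def finite_corners)
  also have "\<dots> = extensions (n - 1) (state [])"
    using sum_extensions[where m = "n - 1" and k = 0] by simp
  finally show ?thesis .
qed

section \<open>The eleven states and the recurrence\<close>

lemma extensions_1: "extensions 1 D = length (succs D)"
proof -
  have "extensions 0 = (\<lambda>_. 1)" by (simp add: fun_eq_iff)
  then show ?thesis by (simp add: sum_list_triv)
qed

text \<open>Eleven of the nineteen strict orders on three elements, a family invariant under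
  exchanging \<open>0\<close> and \<open>2\<close>. The value tables below follow this
  order.\<close>

definition states :: "(nat \<times> nat) list list" where
  "states =
    [[], [(0, 1)], [(2, 1)], [(1, 0)], [(1, 2)], [(0, 1), (2, 1)], [(1, 0), (1, 2)],
     [(0, 1), (0, 2)], [(2, 0), (2, 1)], [(0, 1), (0, 2), (1, 2)], [(1, 0), (2, 0), (2, 1)]]"

lemma succs_state:
  "succs (state []) = map state
    [[], [], [(1, 2)], [(2, 1)], [], [], [(2, 0), (2, 1)], [(0, 1), (0, 2)], [(0, 1)],
     [(0, 1), (0, 2), (1, 2)], [(0, 1), (2, 1)], [(1, 0)], [(1, 0), (1, 2)],
     [(1, 0), (2, 0), (2, 1)]]"
  "succs (state [(0, 1)]) = map state
    [[], [], [(1, 2)], [(2, 1)], [(0, 1), (0, 2)], [(0, 1)], [(0, 1), (0, 2), (1, 2)],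
     [(0, 1), (2, 1)], [(1, 0)], [(1, 0), (1, 2)], [(1, 0), (2, 0), (2, 1)]]"
  "succs (state [(2, 1)]) = map state
    [[], [(1, 2)], [(2, 1)], [], [(2, 0), (2, 1)], [(0, 1)], [(0, 1), (0, 2), (1, 2)],
     [(0, 1), (2, 1)], [(1, 0)], [(1, 0), (1, 2)], [(1, 0), (2, 0), (2, 1)]]"
  "succs (state [(1, 0)]) = map state
    [[], [], [(2, 0), (2, 1)], [(0, 1), (0, 2)], [(0, 1)], [(0, 1), (0, 2), (1, 2)],
     [(0, 1), (2, 1)], [(1, 0)], [(1, 0), (1, 2)], [(1, 0), (2, 0), (2, 1)]]"
  "succs (state [(1, 2)]) = map state
    [[], [(1, 2)], [(2, 1)], [], [(2, 0), (2, 1)], [(0, 1), (0, 2)], [(0, 1), (0, 2), (1, 2)],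
     [(0, 1), (2, 1)], [(1, 0), (1, 2)], [(1, 0), (2, 0), (2, 1)]]"
  "succs (state [(0, 1), (2, 1)]) = map state
    [[], [(1, 2)], [(2, 1)], [(0, 1)], [(0, 1), (0, 2), (1, 2)], [(0, 1), (2, 1)], [(1, 0)],
     [(1, 0), (1, 2)], [(1, 0), (2, 0), (2, 1)]]"
  "succs (state [(1, 0), (1, 2)]) = map state
    [[], [(2, 0), (2, 1)], [(0, 1), (0, 2)], [(0, 1), (0, 2), (1, 2)], [(0, 1), (2, 1)],
     [(1, 0), (1, 2)], [(1, 0), (2, 0), (2, 1)]]"
  "succs (state [(0, 1), (0, 2)]) = map state
    [[], [], [(1, 2)], [(2, 1)], [(0, 1), (0, 2)], [(0, 1), (0, 2)], [(0, 1), (0, 2), (1, 2)],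
     [(0, 1), (2, 1)], [(1, 0), (1, 2)], [(1, 0), (2, 0), (2, 1)]]"
  "succs (state [(2, 0), (2, 1)]) = map state
    [[], [(2, 0), (2, 1)], [], [(2, 0), (2, 1)], [(0, 1)], [(0, 1), (0, 2), (1, 2)],
     [(0, 1), (2, 1)], [(1, 0)], [(1, 0), (1, 2)], [(1, 0), (2, 0), (2, 1)]]"
  "succs (state [(0, 1), (0, 2), (1, 2)]) = map state
    [[], [(1, 2)], [(2, 1)], [(0, 1), (0, 2)], [(0, 1), (0, 2), (1, 2)], [(0, 1), (2, 1)],
     [(1, 0), (1, 2)], [(1, 0), (2, 0), (2, 1)]]"
  "succs (state [(1, 0), (2, 0), (2, 1)]) = map state
    [[], [(2, 0), (2, 1)], [(0, 1)], [(0, 1), (0, 2), (1, 2)], [(0, 1), (2, 1)], [(1, 0)],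
     [(1, 0), (1, 2)], [(1, 0), (2, 0), (2, 1)]]"
  by code_simp+

lemma extensions_states_1:
  "map (\<lambda>p. extensions 1 (state p)) states =
    [14, 11, 11, 10, 10, 9, 7, 10, 10, 8, 8]"
  by (simp add: states_def succs_state extensions_1 del: One_nat_def)

lemma extensions_states_2:
  "map (\<lambda>p. extensions 2 (state p)) states =
    [150, 112, 112, 101, 101, 88, 66, 101, 101, 77, 77]"
  by (simp add: states_def succs_state
      extensions.simps(2)[of 1, unfolded Suc_1]
      extensions_states_1[unfolded states_def list.map list.inject simp_thms] del: One_nat_def)

lemma extensions_states_3:
  "map (\<lambda>p. extensions 3 (state p)) states =
    [1536, 1135, 1135, 1023, 1023, 884, 660, 1023, 1023, 772, 772]"
  by (simp add: states_def succs_state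
      extensions.simps(2)[of 2, unfolded Suc_numeral add_num_simps]
      extensions_states_2[unfolded states_def list.map list.inject simp_thms] del: One_nat_def)

lemma extensions_states_4:
  "map (\<lambda>p. extensions 4 (state p)) states =
    [15594, 11499, 11499, 10364, 10364, 8940, 6670, 10364, 10364, 7805, 7805]"
  by (simp add: states_def succs_state
      extensions.simps(2)[of 3, unfolded Suc_numeral add_num_simps]
      extensions_states_3[unfolded states_def list.map list.inject simp_thms] del: One_nat_def)

lemma succs_closed:
  assumes "D \<in> state ` set states"
  shows "set (succs D) \<subseteq> state ` set states"
  using assms by (auto simp: states_def succs_state simp del: One_nat_def)

text \<open>The tables give the case \<open>k = 0\<close> on all eleven states. Both sides are
  linear in \<open>extensions\<close>, so summing over successors, which are again listed states,
  raises \<open>k\<close>.\<close>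

lemma extensions_recurrence:
  assumes "D \<in> state ` set states"
  shows "extensions (k + 4) D + 31 * extensions (k + 2) D + 4 * extensions k D
    = 13 * extensions (k + 3) D + 20 * extensions (k + 1) D"
  using assms
proof (induction k arbitrary: D)
  case 0
  then show ?case
    unfolding add_0 using extensions_states_1 extensions_states_2 extensions_states_3 extensions_states_4
    by (auto simp: states_def simp del: One_nat_def)
next
  case (Suc k)
  have "(\<Sum>E\<leftarrow>succs D. extensions (k + 4) E + 31 * extensions (k + 2) E + 4 * extensions k E)
      = (\<Sum>E\<leftarrow>succs D. 13 * extensions (k + 3) E + 20 * extensions (k + 1) E)"
    using Suc.IH succs_closed[OF Suc.prems] by (intro arg_cong[of _ _ sum_list] map_cong refl) blast
  then show ?case
    by (simp only: add_Suc extensions.simps sum_list_addf sum_list_const_mult)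
qed

section \<open>From the recurrence to the generating function\<close>

lemma num_vertices_initial: "num_vertices 2 = 14" "num_vertices 3 = 150" "num_vertices 4 = 1536"
proof -
  have "num_vertices 2 = extensions 1 (state [])" "num_vertices 3 = extensions 2 (state [])"
    "num_vertices 4 = extensions 3 (state [])"
    by (simp_all add: num_vertices_eq_extensions del: extensions.simps)
  then show "num_vertices 2 = 14" "num_vertices 3 = 150" "num_vertices 4 = 1536"
    using extensions_states_1 extensions_states_2 extensions_states_3
    by (simp_all add: states_def del: One_nat_def)
qed

lemma num_vertices_recurrence:
  "num_vertices (n + 5) + 31 * num_vertices (n + 3) + 4 * num_vertices (n + 1)
    = 13 * num_vertices (n + 4) + 20 * num_vertices (n + 2)"
proof -
  have "n + 5 - 1 = n + 4" "n + 3 - 1 = n + 2" "n + 1 - 1 = n" "n + 4 - 1 = n + 3" "n + 2 - 1 = n + 1"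
    by simp_all
  moreover have "state [] \<in> state ` set states" by (simp add: states_def)
  ultimately show ?thesis
    unfolding num_vertices_eq_extensions using extensions_recurrence by presburger
qed

theorem theorem1p4:
  shows "fps_X + Abs_fps (\<lambda>n. if 2 \<le> n then of_nat (num_vertices n) else 0) =
           (fps_X + fps_X ^ 2 - fps_X ^ 3) /
           (1 - 13 * fps_X + 31 * fps_X ^ 2 - 20 * fps_X ^ 3 + 4 * fps_X ^ 4 :: rat fps)
         \<and> num_vertices 2 = 14 \<and> num_vertices 3 = 150 \<and> num_vertices 4 = 1536"
proof -
  let ?D = "1 - 13 * fps_X + 31 * fps_X ^ 2 - 20 * fps_X ^ 3 + 4 * fps_X ^ 4 :: rat fps"
  \<comment> \<open>The value at \<open>0\<close> is set to zero because
    \<open>num_vertices 0\<close> is \<open>1\<close> by truncated subtraction. The term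
    \<open>fps_X\<close> is supplied by \<open>num_vertices 1 = 1\<close>, where \<open>Q 1\<close>
    is an empty sum.\<close>
  define v where "v n = (if n = 0 then 0 else rat_of_nat (num_vertices n))" for n
  have v1: "num_vertices 1 = 1"
    by (simp add: num_vertices_eq_extensions)
  have F: "fps_X + Abs_fps (\<lambda>n. if 2 \<le> n then rat_of_nat (num_vertices n) else 0) = Abs_fps v"
    using v1 by (intro fps_ext) (auto simp: v_def le_Suc_eq numeral_2_eq_2 not_le less_Suc_eq)
  have "Abs_fps v * ?D = fps_X + fps_X ^ 2 - fps_X ^ 3"
  proof (rule fps_ext)
    fix n
    have expand: "fps_nth (Abs_fps v * ?D) n = v n - 13 * (if n < 1 then 0 else v (n - 1))
        + 31 * (if n < 2 then 0 else v (n - 2)) - 20 * (if n < 3 then 0 else v (n - 3))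
        + 4 * (if n < 4 then 0 else v (n - 4))"
    proof -
      have "Abs_fps v * ?D = Abs_fps v - fps_const 13 * (fps_X ^ 1 * Abs_fps v)
          + fps_const 31 * (fps_X ^ 2 * Abs_fps v) - fps_const 20 * (fps_X ^ 3 * Abs_fps v)
          + fps_const 4 * (fps_X ^ 4 * Abs_fps v)"
        by (simp add: numeral_fps_const[symmetric] algebra_simps)
      then show ?thesis
        by (simp only: fps_add_nth fps_sub_nth fps_mult_left_const_nth fps_X_power_mult_nth fps_nth_Abs_fps)
    qed
    \<comment> \<open>The recurrence applies from \<open>n = 5\<close>, where its lowest index is
      \<open>1\<close>. The case \<open>n = 4\<close> involves the artificial \<open>v 0\<close> and
      is checked numerically, like those below it.\<close>
    consider "n = 0" | "n = 1" | "n = 2" | "n = 3" | "n = 4" | k where "n = k + 5"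
    proof -
      have "n = 0 \<or> n = 1 \<or> n = 2 \<or> n = 3 \<or> n = 4 \<or> n = (n - 5) + 5" by linarith
      then show ?thesis using that by blast
    qed
    then show "fps_nth (Abs_fps v * ?D) n = fps_nth (fps_X + fps_X ^ 2 - fps_X ^ 3) n"
    proof cases
      case 6
      have "rat_of_nat (num_vertices (k + 5) + 31 * num_vertices (k + 3) + 4 * num_vertices (k + 1))
          = rat_of_nat (13 * num_vertices (k + 4) + 20 * num_vertices (k + 2))"
        by (simp only: num_vertices_recurrence)
      then show ?thesis
        unfolding expand using 6 by (simp add: v_def fps_X_power_nth algebra_simps)
    qed (unfold expand, simp_all add: v_def fps_X_power_nth num_vertices_initial v1[simplified])
  qed
  moreover have "?D \<noteq> 0"
  proof
    assume "?D = 0"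
    then have "fps_nth ?D 0 = 0" by simp
    then show False by simp
  qed
  ultimately have "Abs_fps v = (fps_X + fps_X ^ 2 - fps_X ^ 3) / ?D"
    by (metis nonzero_mult_div_cancel_right)
  then show ?thesis
    unfolding F by (simp add: num_vertices_initial)
qed

end
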